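(* There exists a real Banach space $X$ such that $\inf_{x \in S_X} \delta c(x) = 0$ while $dc(x) > 0$ for every $x \in S_X$.
   Context: All Banach spaces are real. $B_X$, $S_X$, $X^*$ denote the closed unit ball, unit sphere and topological dual of a Banach space $X$. A slice of $B_X$ is a set $S(x^*,\delta)=\{y\in B_X : x^*(y)>1-\delta\}$ with $x^*\in S_{X^*}$ and $\delta>0$. For $x\in B_X$: The Daugavet constant $dc(x)$ is the supremum of all $\alpha\ge 0$ such that for all $\varepsilon,\delta>0$ and all $y^*\in S_{X^*}$ there exists $y\in S(y^*,\delta)$ with $\|y-x\|>\alpha-\varepsilon$. The $\Delta$-constant $\delta c(x)$ is the supremum of all $\alpha\ge 0$ such that for all $\varepsilon,\delta>0$ and all $y^*\in S_{X^*}$ with $x\in S(y^*,\delta)$ there exists $y\in S(y^*,\delta)$ with $\|y-x\|>\alpha-\varepsilon$. *)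

theory Defs
  imports "HOL-Analysis.Analysis" "HOL-Library.Function_Algebras"
begin

text \<open>
  Since HOL cannot quantify existentially over types, a Banach space is represented by a
  linear subspace \<open>V\<close> of an ambient real vector space together with a complete norm \<open>N\<close> on \<open>V\<close>
  (unrelated to any norm or topology on the ambient type). The values of \<open>N\<close> and of functionals
  outside \<open>V\<close> are irrelevant throughout. As ambient space we use the functions
  \<^typ>\<open>real \<Rightarrow> real\<close> with pointwise operations, which have Hamel dimension \<open>2\<close> to the continuum,
  so that every separable Banach space, and every Banach space of at most that dimension,
  is isometrically isomorphic to some \<open>(V, N)\<close>.
\<close>

instantiation "fun" :: (type, real_vector) real_vector
begin

definition scaleR_fun :: "real \<Rightarrow> ('a \<Rightarrow> 'b) \<Rightarrow> 'a \<Rightarrow> 'b"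
  where "scaleR_fun c f = (\<lambda>x. c *\<^sub>R f x)"

instance
  by standard (simp_all add: scaleR_fun_def plus_fun_def scaleR_add_right scaleR_add_left)

end

definition norm_on :: "'a::real_vector set \<Rightarrow> ('a \<Rightarrow> real) \<Rightarrow> bool"
  where "norm_on V N \<longleftrightarrow>
    (\<forall>x\<in>V. N x \<ge> 0) \<and>
    (\<forall>x\<in>V. N x = 0 \<longleftrightarrow> x = 0) \<and>
    (\<forall>x\<in>V. \<forall>y\<in>V. N (x + y) \<le> N x + N y) \<and>
    (\<forall>c. \<forall>x\<in>V. N (c *\<^sub>R x) = \<bar>c\<bar> * N x)"

definition complete_norm_on :: "'a::real_vector set \<Rightarrow> ('a \<Rightarrow> real) \<Rightarrow> bool"
  where "complete_norm_on V N \<longleftrightarrow>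
    (\<forall>u :: nat \<Rightarrow> 'a.
      (\<forall>n. u n \<in> V) \<and> (\<forall>e>0. \<exists>M. \<forall>m\<ge>M. \<forall>n\<ge>M. N (u m - u n) < e) \<longrightarrow>
      (\<exists>l\<in>V. (\<lambda>n. N (u n - l)) \<longlonglongrightarrow> 0))"

definition banach_space_on :: "'a::real_vector set \<Rightarrow> ('a \<Rightarrow> real) \<Rightarrow> bool"
  where "banach_space_on V N \<longleftrightarrow> subspace V \<and> norm_on V N \<and> complete_norm_on V N"

definition unit_ball :: "'a::real_vector set \<Rightarrow> ('a \<Rightarrow> real) \<Rightarrow> 'a set"
  where "unit_ball V N = {x \<in> V. N x \<le> 1}"

definition unit_sphere :: "'a::real_vector set \<Rightarrow> ('a \<Rightarrow> real) \<Rightarrow> 'a set"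
  where "unit_sphere V N = {x \<in> V. N x = 1}"

definition bounded_functional_on :: "'a::real_vector set \<Rightarrow> ('a \<Rightarrow> real) \<Rightarrow> ('a \<Rightarrow> real) \<Rightarrow> bool"
  where "bounded_functional_on V N f \<longleftrightarrow>
    (\<forall>x\<in>V. \<forall>y\<in>V. f (x + y) = f x + f y) \<and>
    (\<forall>c. \<forall>x\<in>V. f (c *\<^sub>R x) = c * f x) \<and>
    (\<exists>K. \<forall>x\<in>V. \<bar>f x\<bar> \<le> K * N x)"

definition dual_norm :: "'a::real_vector set \<Rightarrow> ('a \<Rightarrow> real) \<Rightarrow> ('a \<Rightarrow> real) \<Rightarrow> real"
  where "dual_norm V N f = (SUP x\<in>unit_ball V N. \<bar>f x\<bar>)"

text \<open>
  An element of the dual space is represented by all functions on the ambient type that agree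
  with it on \<open>V\<close>.
\<close>

definition dual_sphere :: "'a::real_vector set \<Rightarrow> ('a \<Rightarrow> real) \<Rightarrow> ('a \<Rightarrow> real) set"
  where "dual_sphere V N = {f. bounded_functional_on V N f \<and> dual_norm V N f = 1}"

definition slice :: "'a::real_vector set \<Rightarrow> ('a \<Rightarrow> real) \<Rightarrow> ('a \<Rightarrow> real) \<Rightarrow> real \<Rightarrow> 'a set"
  where "slice V N f \<delta> = {y \<in> unit_ball V N. f y > 1 - \<delta>}"

text \<open>
  The suprema below are taken in the reals. If \<open>V \<noteq> {0}\<close> and \<open>x\<close> lies in the unit ball, then the
  sets contain \<open>0\<close> and are bounded above by \<open>2\<close>, so these are genuine suprema.
\<close>

definition daugavet_const :: "'a::real_vector set \<Rightarrow> ('a \<Rightarrow> real) \<Rightarrow> 'a \<Rightarrow> real"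
  where "daugavet_const V N x = Sup {\<alpha>. \<alpha> \<ge> 0 \<and>
    (\<forall>\<epsilon>>0. \<forall>\<delta>>0. \<forall>f\<in>dual_sphere V N. \<exists>y\<in>slice V N f \<delta>. N (y - x) > \<alpha> - \<epsilon>)}"

definition delta_const :: "'a::real_vector set \<Rightarrow> ('a \<Rightarrow> real) \<Rightarrow> 'a \<Rightarrow> real"
  where "delta_const V N x = Sup {\<alpha>. \<alpha> \<ge> 0 \<and>
    (\<forall>\<epsilon>>0. \<forall>\<delta>>0. \<forall>f\<in>dual_sphere V N. x \<in> slice V N f \<delta> \<longrightarrow>
      (\<exists>y\<in>slice V N f \<delta>. N (y - x) > \<alpha> - \<epsilon>))}"

end

theory Submission
  imports Defs
begin

text \<open>
  Consider pairs \<open>x = (t, y)\<close> with \<open>t \<in> \<ell>\<^sub>1(B)\<close> and \<open>y \<in> \<ell>\<^sub>\<infinity>(- B)\<close>, with the norm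
  \<open>max (\<Sum>\<^sub>r \<bar>t\<^sub>r\<bar>) (\<parallel>y\<parallel>\<^sub>\<infinity> + \<Sum>\<^sub>r (1 - e\<^sub>r) \<bar>t\<^sub>r\<bar>)\<close> for weights \<open>0 < e\<^sub>r \<le> 1\<close> with infimum \<open>0\<close>. Its unit ball
  is the closed convex hull of the points \<open>(0, y)\<close> and \<open>(\<plusminus>\<delta>\<^sub>r, e\<^sub>r y)\<close> with \<open>\<parallel>y\<parallel>\<^sub>\<infinity> \<le> 1\<close>. The slice at
  \<open>(\<delta>\<^sub>r, 0)\<close> cut out by the \<open>r\<close>-th coordinate has radius about \<open>e\<^sub>r\<close>, so the infimum of the
  \<open>\<Delta>\<close>-constants is \<open>0\<close>.

  On the other hand every slice contains one of the points above. A functional is small on some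
  unit vector of \<open>\<ell>\<^sub>\<infinity>\<close>, so the corresponding coordinate of \<open>y\<close> may be set to \<open>1\<close> or \<open>-1\<close> without
  leaving the slice, which makes the distance to a given \<open>x\<close> at least \<open>1\<close> resp. \<open>e\<^sub>r\<close>. In the
  second case the distance is also at least \<open>1 - \<bar>t\<^sub>r\<bar>\<close>, and \<open>\<bar>t\<^sub>r\<bar> > 1/2\<close> for at most one \<open>r\<close>; hence
  the distance is bounded below in terms of \<open>x\<close> alone.
\<close>

lemma scaleR_fun_apply: "(c *\<^sub>R f) i = c *\<^sub>R f i"
  by (simp add: scaleR_fun_def)

text \<open>Only an inequality, because \<open>r\<close> may lie outside \<open>F\<close>: the
  vertices are tested against arbitrary finite \<open>F\<close>.\<close>

lemma sum_single_le:
  fixes g :: "'a \<Rightarrow> real"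
  assumes "finite F" "g r \<ge> 0" "\<And>s. s \<in> F \<Longrightarrow> s \<noteq> r \<Longrightarrow> g s = 0"
  shows "sum g F \<le> g r"
proof -
  have "sum g F = (\<Sum>s\<in>F. if s = r then g r else 0)"
    using assms(3) by (intro sum.cong) auto
  then show ?thesis using assms(1,2) by simp
qed

section \<open>The space, its norm and completeness\<close>

locale l1_linf_sum =
  fixes B :: "'a set" and e :: "'a \<Rightarrow> real"
  assumes inf_compl: "infinite (- B)"
    and e_pos: "r \<in> B \<Longrightarrow> 0 < e r" and e_le: "r \<in> B \<Longrightarrow> e r \<le> 1"
begin

text \<open>An index names a finite part of \<open>B\<close> and one coordinate outside
  \<open>B\<close>. Each seminorm \<open>p i\<close> thus involves only finitely many coordinates,
  so no infinite sums occur and estimates pass to coordinatewise limits.\<close>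

definition idx :: "('a set \<times> 'a) set"
  where "idx = {(F, a). finite F \<and> F \<subseteq> B \<and> a \<notin> B}"

definition p :: "'a set \<times> 'a \<Rightarrow> ('a \<Rightarrow> real) \<Rightarrow> real"
  where "p i x = max (\<Sum>r\<in>fst i. \<bar>x r\<bar>) (\<bar>x (snd i)\<bar> + (\<Sum>r\<in>fst i. (1 - e r) * \<bar>x r\<bar>))"

text \<open>These are the functions that are absolutely summable on \<open>B\<close> and bounded off
  \<open>B\<close>, since the weights \<open>1 - e r\<close> lie in [0, 1).\<close>

definition V :: "('a \<Rightarrow> real) set"
  where "V = {x. bdd_above ((\<lambda>i. p i x) ` idx)}"

definition N :: "('a \<Rightarrow> real) \<Rightarrow> real"
  where "N x = (SUP i\<in>idx. p i x)"

lemma idx_nonempty: "idx \<noteq> {}"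
proof -
  obtain a where "a \<notin> B" using inf_compl by (metis ComplD finite.emptyI ex_in_conv)
  then have "({}, a) \<in> idx" by (simp add: idx_def)
  then show ?thesis by blast
qed

lemma p_le_N: "x \<in> V \<Longrightarrow> i \<in> idx \<Longrightarrow> p i x \<le> N x"
  unfolding N_def V_def by (auto intro: cSUP_upper)

lemma N_leI: "(\<And>i. i \<in> idx \<Longrightarrow> p i x \<le> c) \<Longrightarrow> N x \<le> c"
  unfolding N_def using idx_nonempty by (auto intro: cSUP_least)

lemma V_I: "(\<And>i. i \<in> idx \<Longrightarrow> p i x \<le> c) \<Longrightarrow> x \<in> V"
  unfolding V_def by (auto intro!: bdd_aboveI2[where M = c])

lemma p_nonneg: "0 \<le> p i x"
  by (simp add: p_def le_max_iff_disj sum_nonneg)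

lemma p_triangle:
  assumes "i \<in> idx"
  shows "p i (x + y) \<le> p i x + p i y"
proof -
  have 1: "(\<Sum>r\<in>fst i. \<bar>x r + y r\<bar>) \<le> (\<Sum>r\<in>fst i. \<bar>x r\<bar>) + (\<Sum>r\<in>fst i. \<bar>y r\<bar>)"
    by (simp add: sum.distrib[symmetric] sum_mono abs_triangle_ineq)
  have "(\<Sum>r\<in>fst i. (1 - e r) * \<bar>x r + y r\<bar>)
      \<le> (\<Sum>r\<in>fst i. (1 - e r) * (\<bar>x r\<bar> + \<bar>y r\<bar>))"
    using assms e_le by (intro sum_mono mult_left_mono abs_triangle_ineq) (auto simp: idx_def)
  then have 2: "(\<Sum>r\<in>fst i. (1 - e r) * \<bar>x r + y r\<bar>)
      \<le> (\<Sum>r\<in>fst i. (1 - e r) * \<bar>x r\<bar>) + (\<Sum>r\<in>fst i. (1 - e r) * \<bar>y r\<bar>)"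
    by (simp add: sum.distrib distrib_left)
  show ?thesis
    using 1 2 abs_triangle_ineq[of "x (snd i)" "y (snd i)"]
    unfolding p_def plus_fun_apply by linarith
qed

lemma p_scaleR: "p i (c *\<^sub>R x) = \<bar>c\<bar> * p i x"
proof -
  have "(\<Sum>r\<in>fst i. (1 - e r) * (\<bar>c\<bar> * \<bar>x r\<bar>)) = \<bar>c\<bar> * (\<Sum>r\<in>fst i. (1 - e r) * \<bar>x r\<bar>)"
    by (simp add: sum_distrib_left mult_ac)
  then show ?thesis
    by (simp add: p_def scaleR_fun_apply abs_mult sum_distrib_left[symmetric]
        distrib_left[symmetric] max_mult_distrib_left)
qed

lemma N_nonneg: "x \<in> V \<Longrightarrow> 0 \<le> N x"
  using idx_nonempty p_le_N p_nonneg by (metis ex_in_conv order_trans)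

lemma V_add: "x \<in> V \<Longrightarrow> y \<in> V \<Longrightarrow> x + y \<in> V"
  by (rule V_I[where c = "N x + N y"]) (meson add_mono order_trans p_le_N p_triangle)

lemma N_triangle: "x \<in> V \<Longrightarrow> y \<in> V \<Longrightarrow> N (x + y) \<le> N x + N y"
  by (rule N_leI) (meson add_mono order_trans p_le_N p_triangle)

lemma V_scaleR: "x \<in> V \<Longrightarrow> c *\<^sub>R x \<in> V"
  by (rule V_I[where c = "\<bar>c\<bar> * N x"]) (simp add: p_scaleR mult_left_mono p_le_N)

lemma N_scaleR_le: "x \<in> V \<Longrightarrow> N (c *\<^sub>R x) \<le> \<bar>c\<bar> * N x"
  by (rule N_leI) (simp add: p_scaleR mult_left_mono p_le_N)

lemma zero_in_V: "0 \<in> V"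
  by (rule V_I[where c = 0]) (simp add: p_def)

lemma N_zero: "N 0 = 0"
  using N_leI[of 0 0] N_nonneg[OF zero_in_V] by (simp add: p_def)

lemma N_scaleR:
  assumes "x \<in> V"
  shows "N (c *\<^sub>R x) = \<bar>c\<bar> * N x"
proof (cases "c = 0")
  case False
  have "N x = N (inverse c *\<^sub>R (c *\<^sub>R x))" using False by simp
  also have "\<dots> \<le> \<bar>inverse c\<bar> * N (c *\<^sub>R x)" by (intro N_scaleR_le V_scaleR assms)
  finally have "\<bar>c\<bar> * N x \<le> N (c *\<^sub>R x)" using False by (simp add: field_simps abs_inverse)
  then show ?thesis using N_scaleR_le[OF assms, of c] by simp
qed (simp add: N_zero)

lemma V_diff: "x \<in> V \<Longrightarrow> y \<in> V \<Longrightarrow> x - y \<in> V"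
  using V_add[of x "(-1) *\<^sub>R y"] V_scaleR[of y "-1"] by simp

lemma N_diff_le: "x \<in> V \<Longrightarrow> y \<in> V \<Longrightarrow> N (x - y) \<le> N x + N y"
  using N_triangle[of x "(-1) *\<^sub>R y"] V_scaleR[of y "-1"] N_scaleR[of y "-1"] by simp

lemma subspace_V: "subspace V"
  by (simp add: subspace_def zero_in_V V_add V_scaleR)

lemma sum_le_N:
  assumes "x \<in> V" "finite F" "F \<subseteq> B"
  shows "(\<Sum>r\<in>F. \<bar>x r\<bar>) \<le> N x"
proof -
  obtain a where "a \<notin> B" using inf_compl by (metis ComplD finite.emptyI ex_in_conv)
  then show ?thesis using p_le_N[of x "(F, a)"] assms by (simp add: p_def idx_def)
qed

lemma abs_add_sum_le_N:
  assumes "x \<in> V" "finite F" "F \<subseteq> B" "a \<notin> B"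
  shows "\<bar>x a\<bar> + (\<Sum>r\<in>F. (1 - e r) * \<bar>x r\<bar>) \<le> N x"
  using p_le_N[of x "(F, a)"] assms by (simp add: p_def idx_def)

lemma abs_le_N: "x \<in> V \<Longrightarrow> \<bar>x a\<bar> \<le> N x"
  using sum_le_N[of x "{a}"] abs_add_sum_le_N[of x "{}" a] by (cases "a \<in> B") auto

lemma in_V_N_leI:
  assumes "\<And>F. finite F \<Longrightarrow> F \<subseteq> B \<Longrightarrow> (\<Sum>r\<in>F. \<bar>x r\<bar>) \<le> c"
    and "\<And>F a. finite F \<Longrightarrow> F \<subseteq> B \<Longrightarrow> a \<notin> B \<Longrightarrow> \<bar>x a\<bar> + (\<Sum>r\<in>F. (1 - e r) * \<bar>x r\<bar>) \<le> c"
  shows "x \<in> V" "N x \<le> c"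
proof -
  have "p i x \<le> c" if "i \<in> idx" for i
    using that assms by (auto simp: p_def idx_def)
  then show "x \<in> V" "N x \<le> c" by (fact V_I, fact N_leI)
qed

lemma norm_on_V: "norm_on V N"
proof -
  have "x = 0" if "x \<in> V" "N x = 0" for x
    using abs_le_N[OF that(1)] that(2) by (auto simp: fun_eq_iff)
  then show ?thesis
    by (auto simp: norm_on_def N_nonneg N_zero N_triangle N_scaleR)
qed

text \<open>The limit is taken coordinatewise. Each \<open>p i\<close> is continuous in finitely
  many coordinates, so the Cauchy estimate passes to the limit for every \<open>i\<close>, with a
  threshold \<open>M\<close> independent of \<open>i\<close>.\<close>

lemma complete_norm_on_V: "complete_norm_on V N"
  unfolding complete_norm_on_def
proof (intro allI impI, elim conjE)
  fix u :: "nat \<Rightarrow> 'a \<Rightarrow> real"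
  assume uV: "\<forall>n. u n \<in> V" and cau: "\<forall>\<epsilon>>0. \<exists>M. \<forall>m\<ge>M. \<forall>n\<ge>M. N (u m - u n) < \<epsilon>"
  have "Cauchy (\<lambda>n. u n a)" for a
    unfolding Cauchy_def dist_real_def
    using cau abs_le_N[OF V_diff, of "u _" "u _" a] uV
    by (metis (no_types, lifting) minus_apply order_le_less_trans)
  then have "\<exists>l. (\<lambda>n. u n a) \<longlonglongrightarrow> l" for a
    by (simp add: Cauchy_convergent_iff convergent_def)
  then obtain l where l: "(\<lambda>n. u n a) \<longlonglongrightarrow> l a" for a by metis
  have tail: "\<exists>M. \<forall>n\<ge>M. u n - l \<in> V \<and> N (u n - l) \<le> \<epsilon>" if "\<epsilon> > 0" for \<epsilon>
  proof -
    obtain M where M: "\<forall>m\<ge>M. \<forall>n\<ge>M. N (u m - u n) < \<epsilon>" using cau \<open>\<epsilon> > 0\<close> by blast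
    have "p i (u n - l) \<le> \<epsilon>" if "n \<ge> M" "i \<in> idx" for n i
    proof (rule tendsto_upperbound)
      show "(\<lambda>m. p i (u n - u m)) \<longlonglongrightarrow> p i (u n - l)"
        unfolding p_def by (auto simp: intro!: tendsto_intros l)
      show "\<forall>\<^sub>F m in sequentially. p i (u n - u m) \<le> \<epsilon>"
        unfolding eventually_sequentially
        using M that p_le_N[OF V_diff] uV by (meson less_imp_le order_trans)
    qed auto
    then show ?thesis by (metis V_I N_leI)
  qed
  obtain M where "u M - l \<in> V" using tail[of 1] by auto
  then have "u M - (u M - l) \<in> V" using uV V_diff by blast
  then have lV: "l \<in> V" by simp
  have "(\<lambda>n. N (u n - l)) \<longlonglongrightarrow> 0"
  proof (rule LIMSEQ_I)
    fix \<epsilon> :: real assume "0 < \<epsilon>"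
    then obtain M where "\<forall>n\<ge>M. u n - l \<in> V \<and> N (u n - l) \<le> \<epsilon> / 2"
      using tail[of "\<epsilon> / 2"] by auto
    then show "\<exists>M. \<forall>n\<ge>M. norm (N (u n - l) - 0) < \<epsilon>"
      using \<open>0 < \<epsilon>\<close> N_nonneg by (intro exI[of _ M]) fastforce
  qed
  then show "\<exists>l\<in>V. (\<lambda>n. N (u n - l)) \<longlonglongrightarrow> 0" using lV by blast
qed

lemma banach_space_on_V: "banach_space_on V N"
  by (simp add: banach_space_on_def subspace_V norm_on_V complete_norm_on_V)

section \<open>Vertices of the unit ball, and truncations\<close>

definition unit_vec :: "'a \<Rightarrow> 'a \<Rightarrow> real"
  where "unit_vec k = (\<lambda>i. of_bool (i = k))"

text \<open>This is the unit ball of the bounded summand, embedded by zero on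
  \<open>B\<close>.\<close>

definition Y :: "('a \<Rightarrow> real) set"
  where "Y = {y. (\<forall>r\<in>B. y r = 0) \<and> (\<forall>a. \<bar>y a\<bar> \<le> 1)}"

lemma Y_ball:
  assumes "y \<in> Y"
  shows "y \<in> V" "N y \<le> 1"
proof -
  have 0: "(\<Sum>r\<in>F. \<bar>y r\<bar>) = 0" "(\<Sum>r\<in>F. (1 - e r) * \<bar>y r\<bar>) = 0" if "F \<subseteq> B" for F
    using assms that by (auto simp: Y_def intro!: sum.neutral)
  show "y \<in> V" "N y \<le> 1"
    by (rule in_V_N_leI[of y 1]; use 0 assms in \<open>force simp: Y_def\<close>)+
qed

text \<open>A full unit of mass at \<open>r\<close> uses up \<open>1 - e r\<close> of the second
  term in the norm, which leaves exactly \<open>e r\<close> for the coordinates outside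
  \<open>B\<close>.\<close>

lemma vertex_ball:
  assumes "y \<in> Y" "r \<in> B" "\<bar>s\<bar> = 1"
  shows "e r *\<^sub>R y + s *\<^sub>R unit_vec r \<in> V" "N (e r *\<^sub>R y + s *\<^sub>R unit_vec r) \<le> 1"
proof -
  let ?v = "e r *\<^sub>R y + s *\<^sub>R unit_vec r"
  have off: "?v t = 0" if "t \<in> B" "t \<noteq> r" for t
    using that assms by (simp add: Y_def unit_vec_def scaleR_fun_apply)
  have at: "\<bar>?v r\<bar> = 1"
    using assms by (simp add: Y_def unit_vec_def scaleR_fun_apply)
  have 1: "(\<Sum>t\<in>F. \<bar>?v t\<bar>) \<le> 1" if "finite F" "F \<subseteq> B" for F
    using sum_single_le[OF that(1), of "\<lambda>t. \<bar>?v t\<bar>" r] off at that(2) by (simp add: subsetD)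
  have 2: "\<bar>?v a\<bar> + (\<Sum>t\<in>F. (1 - e t) * \<bar>?v t\<bar>) \<le> 1"
    if "finite F" "F \<subseteq> B" "a \<notin> B" for F a
  proof -
    have "(\<Sum>t\<in>F. (1 - e t) * \<bar>?v t\<bar>) \<le> 1 - e r"
      using sum_single_le[OF that(1), of "\<lambda>t. (1 - e t) * \<bar>?v t\<bar>" r] off at e_le assms(2) that(2)
      by (simp add: subsetD)
    moreover have "\<bar>?v a\<bar> \<le> e r"
      using assms that(3) e_pos[OF assms(2)]
      by (auto simp: Y_def unit_vec_def scaleR_fun_apply abs_mult mult_left_le)
    ultimately show ?thesis by simp
  qed
  show "?v \<in> V" "N ?v \<le> 1" by (rule in_V_N_leI[of ?v 1]; fact 1 2)+
qed

lemma unit_vec_V: "unit_vec k \<in> V" and N_unit_vec: "N (unit_vec k) = 1"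
proof -
  have *: "unit_vec k \<in> V \<and> N (unit_vec k) \<le> 1"
  proof (cases "k \<in> B")
    case True
    then show ?thesis using vertex_ball[of 0 k 1] by (auto simp: Y_def)
  next
    case False
    then have "unit_vec k \<in> Y" by (auto simp: Y_def unit_vec_def)
    then show ?thesis using Y_ball by blast
  qed
  then show "unit_vec k \<in> V" by simp
  then show "N (unit_vec k) = 1" using * abs_le_N[of "unit_vec k" k] by (simp add: unit_vec_def)
qed

text \<open>The norm is monotone in the absolute values of the coordinates, so deleting coordinates
  cannot increase it.\<close>

lemma restrict_V:
  assumes "x \<in> V"
  shows "(\<lambda>i. if i \<in> A then x i else 0) \<in> V"
    and "N (\<lambda>i. if i \<in> A then x i else 0) \<le> N x"
proof -
  let ?z = "\<lambda>i. if i \<in> A then x i else 0"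
  have 1: "(\<Sum>r\<in>F. \<bar>?z r\<bar>) \<le> N x" if "finite F" "F \<subseteq> B" for F
    using sum_le_N[OF assms that] by (smt (verit) abs_zero abs_ge_zero sum_mono)
  have 2: "\<bar>?z a\<bar> + (\<Sum>r\<in>F. (1 - e r) * \<bar>?z r\<bar>) \<le> N x"
    if "finite F" "F \<subseteq> B" "a \<notin> B" for F a
  proof -
    have "(\<Sum>r\<in>F. (1 - e r) * \<bar>?z r\<bar>) \<le> (\<Sum>r\<in>F. (1 - e r) * \<bar>x r\<bar>)"
      using that e_le by (intro sum_mono mult_left_mono) auto
    then show ?thesis using abs_add_sum_le_N[OF assms that] by (auto split: if_splits)
  qed
  show "?z \<in> V" "N ?z \<le> N x" by (rule in_V_N_leI[of ?z "N x"]; fact 1 2)+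
qed

text \<open>Take \<open>F\<close> whose partial sum comes within \<eta> of the supremum of all
  finite partial sums over \<open>B\<close>; a finite set disjoint from \<open>F\<close> can then
  add at most \<eta>.\<close>

lemma small_tail:
  assumes "x \<in> V" "\<eta> > 0"
  obtains F where "finite F" "F \<subseteq> B"
    "\<And>G. finite G \<Longrightarrow> G \<subseteq> B - F \<Longrightarrow> (\<Sum>r\<in>G. \<bar>x r\<bar>) \<le> \<eta>"
proof -
  let ?A = "{F. finite F \<and> F \<subseteq> B}" and ?s = "\<lambda>F. \<Sum>r\<in>F. \<bar>x r\<bar>"
  have bdd: "bdd_above (?s ` ?A)" using sum_le_N[OF assms(1)] by (intro bdd_aboveI2[where M = "N x"]) auto
  have ne: "?A \<noteq> {}" by blast
  have "(SUP F\<in>?A. ?s F) - \<eta> < (SUP F\<in>?A. ?s F)" using assms by simp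
  then obtain F where F: "F \<in> ?A" "(SUP F\<in>?A. ?s F) - \<eta> < ?s F"
    using less_cSUP_iff[OF ne bdd] by blast
  have "?s G \<le> \<eta>" if "finite G" "G \<subseteq> B - F" for G
  proof -
    have "?s (F \<union> G) \<le> (SUP F\<in>?A. ?s F)" using F that bdd by (intro cSUP_upper) auto
    moreover have "?s (F \<union> G) = ?s F + ?s G" using F that by (intro sum.union_disjoint) auto
    ultimately show ?thesis using F(2) by linarith
  qed
  then show thesis using that F(1) by blast
qed

section \<open>Bounded functionals: bounds from vertices, and coordinates of small effect\<close>

context
  fixes f :: "('a \<Rightarrow> real) \<Rightarrow> real"
  assumes f: "bounded_functional_on V N f"
begin

lemma f_add: "x \<in> V \<Longrightarrow> y \<in> V \<Longrightarrow> f (x + y) = f x + f y"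
  and f_scaleR: "x \<in> V \<Longrightarrow> f (c *\<^sub>R x) = c * f x"
  using f by (auto simp: bounded_functional_on_def)

lemma f_bound:
  obtains K where "K \<ge> 0" "\<And>x. x \<in> V \<Longrightarrow> \<bar>f x\<bar> \<le> K * N x"
proof -
  obtain K where K: "\<forall>x\<in>V. \<bar>f x\<bar> \<le> K * N x" using f by (auto simp: bounded_functional_on_def)
  then have "\<bar>f x\<bar> \<le> \<bar>K\<bar> * N x" if "x \<in> V" for x
    using that N_nonneg[OF that] by (meson abs_ge_self mult_right_mono order_trans)
  then show thesis using that[of "\<bar>K\<bar>"] by simp
qed

text \<open>Only the coordinates in \<open>F\<close> are split into unit vectors. Those outside
  \<open>B\<close> stay together, since a bounded family is in general no norm limit of finite
  combinations of unit vectors.\<close>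

lemma f_finite_decomp:
  assumes "x \<in> V" "finite F" "F \<subseteq> B"
  shows "f (\<lambda>i. if i \<in> - B \<union> F then x i else 0)
    = f (\<lambda>i. if i \<in> - B then x i else 0) + (\<Sum>r\<in>F. x r * f (unit_vec r))"
  using assms(2,3)
proof (induction F rule: finite_induct)
  case (insert r F)
  have "(\<lambda>i. if i \<in> - B \<union> insert r F then x i else 0)
      = (\<lambda>i. if i \<in> - B \<union> F then x i else 0) + x r *\<^sub>R unit_vec r"
    using insert by (auto simp: fun_eq_iff scaleR_fun_apply unit_vec_def)
  then show ?case
    using insert restrict_V(1)[OF assms(1), of "- B \<union> F"]
    by (simp add: f_add f_scaleR V_scaleR unit_vec_V del: Un_iff)
qed simp

text \<open>This is the convex hull description of the ball, in terms of one functional. For a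
  truncation to finite \<open>F\<close>, the norm leaves room \<open>w\<close> for the part
  \<open>z\<close> outside \<open>B\<close>, and \<open>w\<close> equals \<open>1 - S\<close> plus
  the sum of \<open>e r * \<bar>x r\<bar>\<close>. So the truncation is a convex combination of
  \<open>y\<close> with weight \<open>1 - S\<close> and of vertices over \<open>r\<close> with
  weights \<open>\<bar>x r\<bar>\<close>. Continuity of \<open>f\<close> handles the remaining
  tail.\<close>

lemma f_le_of_vertices:
  assumes "\<And>y. y \<in> Y \<Longrightarrow> f y \<le> c"
    and "\<And>y r s. y \<in> Y \<Longrightarrow> r \<in> B \<Longrightarrow> \<bar>s\<bar> = 1 \<Longrightarrow> f (e r *\<^sub>R y + s *\<^sub>R unit_vec r) \<le> c"
    and x: "x \<in> V" "N x \<le> 1"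
  shows "f x \<le> c"
proof -
  have fin: "f (\<lambda>i. if i \<in> - B \<union> F then x i else 0) \<le> c" if F: "finite F" "F \<subseteq> B" for F
  proof -
    define z where "z = (\<lambda>i. if i \<in> - B then x i else 0)"
    define S where "S = (\<Sum>r\<in>F. \<bar>x r\<bar>)"
    define w where "w = 1 - (\<Sum>r\<in>F. (1 - e r) * \<bar>x r\<bar>)"
    define y where "y = (\<lambda>i. z i / w)"
    have S1: "S \<le> 1" using sum_le_N[OF x(1) F] x(2) by (simp add: S_def)
    have "(\<Sum>r\<in>F. (1 - e r) * \<bar>x r\<bar>) \<le> S"
      unfolding S_def using F e_pos by (intro sum_mono) (auto simp: mult_left_le_one_le e_le less_imp_le subsetD)
    then have w0: "w \<ge> 0" using S1 by (simp add: w_def)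
    have zw: "\<bar>z i\<bar> \<le> w" for i
      using abs_add_sum_le_N[OF x(1) F, of i] x(2) w0 by (auto simp: z_def w_def)
    \<comment> \<open>If \<open>w = 0\<close>, then \<open>zw\<close> forces \<open>z = 0\<close>,
      and division by zero makes \<open>y = 0\<close>, so both this and
      \<open>z = w *\<^sub>R y\<close> persist.\<close>
    have yY: "y \<in> Y" using zw w0 by (auto simp: Y_def y_def z_def divide_le_eq)
    have "z = w *\<^sub>R y" using zw by (cases "w = 0") (auto simp: fun_eq_iff scaleR_fun_apply y_def)
    then have fz: "f z = w * f y" using Y_ball(1)[OF yY] f_scaleR by simp
    have "x r * f (unit_vec r) \<le> \<bar>x r\<bar> * (c - e r * f y)" if "r \<in> F" for r
    proof -
      \<comment> \<open>The vertex is taken on the side of \<open>x r\<close>, so that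
        \<open>\<bar>x r\<bar> * s = x r\<close>.\<close>
      define s :: real where "s = (if x r \<ge> 0 then 1 else - 1)"
      have "f (e r *\<^sub>R y + s *\<^sub>R unit_vec r) \<le> c"
        using assms(2) yY that F by (simp add: s_def subsetD)
      then have "s * f (unit_vec r) \<le> c - e r * f y"
        using Y_ball(1)[OF yY] by (simp add: f_add f_scaleR V_scaleR unit_vec_V)
      then have "\<bar>x r\<bar> * (s * f (unit_vec r)) \<le> \<bar>x r\<bar> * (c - e r * f y)"
        by (rule mult_left_mono) simp
      then show ?thesis by (auto simp: s_def split: if_splits)
    qed
    then have "(\<Sum>r\<in>F. x r * f (unit_vec r)) \<le> (\<Sum>r\<in>F. \<bar>x r\<bar> * (c - e r * f y))"
      by (rule sum_mono)
    \<comment> \<open>\<open>S - (1 - w)\<close> is the sum of \<open>e r * \<bar>x r\<bar>\<close>;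
      together with \<open>f z = w * f y\<close> this leaves the coefficient \<open>1 - S\<close>
      for \<open>f y\<close>.\<close>
    also have "\<dots> = S * c - (S - (1 - w)) * f y"
      by (simp add: S_def w_def sum_distrib_right sum_distrib_left algebra_simps sum_subtractf sum.distrib)
    finally have "f z + (\<Sum>r\<in>F. x r * f (unit_vec r)) \<le> S * c + (1 - S) * f y"
      by (simp add: fz algebra_simps)
    also have "\<dots> \<le> S * c + (1 - S) * c"
      using S1 assms(1)[OF yY] by (simp add: mult_left_mono)
    finally show ?thesis using f_finite_decomp[OF x(1) F] by (simp add: z_def algebra_simps)
  qed
  obtain K where K: "K \<ge> 0" "\<And>x. x \<in> V \<Longrightarrow> \<bar>f x\<bar> \<le> K * N x" using f_bound by blast
  show ?thesis
  proof (rule field_le_epsilon)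
    fix \<theta> :: real assume "\<theta> > 0"
    \<comment> \<open>The tail contributes at most \<open>K * \<eta>\<close>, which is to be at most
      \<theta>; the denominator \<open>K + 1\<close> also covers \<open>K = 0\<close>.\<close>
    define \<eta> where "\<eta> = \<theta> / (K + 1)"
    have "\<eta> > 0" using \<open>\<theta> > 0\<close> K by (simp add: \<eta>_def)
    then obtain F where F: "finite F" "F \<subseteq> B"
      "\<And>G. finite G \<Longrightarrow> G \<subseteq> B - F \<Longrightarrow> (\<Sum>r\<in>G. \<bar>x r\<bar>) \<le> \<eta>"
      using small_tail[OF x(1)] by blast
    define z where "z = (\<lambda>i. if i \<in> B - F then x i else 0)"
    have 1: "(\<Sum>r\<in>G. \<bar>z r\<bar>) \<le> \<eta>" if "finite G" "G \<subseteq> B" for G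
    proof -
      have "(\<Sum>r\<in>G. \<bar>z r\<bar>) = (\<Sum>r\<in>G - F. \<bar>x r\<bar>)"
        using that by (intro sum.mono_neutral_cong_right) (auto simp: z_def)
      then show ?thesis using F(3)[of "G - F"] that by auto
    qed
    have 2: "\<bar>z a\<bar> + (\<Sum>r\<in>G. (1 - e r) * \<bar>z r\<bar>) \<le> \<eta>"
      if "finite G" "G \<subseteq> B" "a \<notin> B" for G a
    proof -
      have "(\<Sum>r\<in>G. (1 - e r) * \<bar>z r\<bar>) \<le> (\<Sum>r\<in>G. \<bar>z r\<bar>)"
        using that e_pos e_le by (intro sum_mono) (auto simp: mult_left_le_one_le less_imp_le subsetD)
      then show ?thesis using 1[OF that(1,2)] that(3) by (simp add: z_def)
    qed
    have z: "z \<in> V" "N z \<le> \<eta>" by (rule in_V_N_leI[of z \<eta>]; fact 1 2)+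
    have "x = (\<lambda>i. if i \<in> - B \<union> F then x i else 0) + z"
      by (auto simp: fun_eq_iff z_def)
    then have "f x = f ((\<lambda>i. if i \<in> - B \<union> F then x i else 0) + z)" by (rule arg_cong)
    also have "\<dots> = f (\<lambda>i. if i \<in> - B \<union> F then x i else 0) + f z"
      by (rule f_add[OF restrict_V(1)[OF x(1)] z(1)])
    also have "\<dots> \<le> c + K * \<eta>"
      using fin[OF F(1,2)] K(2)[OF z(1)] mult_left_mono[OF z(2) K(1)] by linarith
    also have "K * \<eta> \<le> \<theta>" using K(1) \<open>\<theta> > 0\<close> by (simp add: \<eta>_def field_simps)
    finally show "f x \<le> c + \<theta>" by simp
  qed
qed

text \<open>The restriction of a bounded functional to \<open>c\<^sub>0\<close> has absolutely summable coefficients.\<close>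

lemma small_coordinate:
  assumes "\<eta> > 0"
  shows "\<exists>k. k \<notin> B \<and> \<bar>f (unit_vec k)\<bar> < \<eta>"
proof (rule ccontr)
  assume "\<nexists>k. k \<notin> B \<and> \<bar>f (unit_vec k)\<bar> < \<eta>"
  then have big: "\<bar>f (unit_vec k)\<bar> \<ge> \<eta>" if "k \<notin> B" for k using that by force
  obtain K where K: "K \<ge> 0" "\<And>x. x \<in> V \<Longrightarrow> \<bar>f x\<bar> \<le> K * N x" using f_bound by blast
  \<comment> \<open>Adding \<open>n\<close> such coordinates with matching signs gives a point of
    the unit ball at which \<open>f\<close> is at least \<open>n * \<eta>\<close>, exceeding the
    bound \<open>K\<close>.\<close>
  obtain n :: nat where n: "K < n * \<eta>" using assms reals_Archimedean3 by blast
  obtain F where F: "finite F" "card F = n" "F \<subseteq> - B"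
    using infinite_arbitrarily_large[OF inf_compl] by blast
  define y where "y = (\<lambda>A i. if i \<in> A then sgn (f (unit_vec i)) else 0)"
  have yY: "y A \<in> Y" if "A \<subseteq> - B" for A
    using that by (auto simp: Y_def y_def sgn_if)
  have "f (y F) = (\<Sum>k\<in>F. \<bar>f (unit_vec k)\<bar>)"
    using F(1,3)
  proof (induction F rule: finite_induct)
    case empty
    have "y {} = 0" by (auto simp: y_def fun_eq_iff)
    moreover have "f 0 = 0" using f_scaleR[OF zero_in_V, of 0] by simp
    ultimately show ?case by (simp only: sum.empty)
  next
    case (insert k F)
    have "y (insert k F) = y F + sgn (f (unit_vec k)) *\<^sub>R unit_vec k"
      using insert by (auto simp: y_def fun_eq_iff scaleR_fun_apply unit_vec_def)
    then have "f (y (insert k F)) = f (y F + sgn (f (unit_vec k)) *\<^sub>R unit_vec k)"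
      by (rule arg_cong)
    also have "\<dots> = f (y F) + \<bar>f (unit_vec k)\<bar>"
      using insert.prems Y_ball(1)[OF yY, of F]
      by (simp add: f_add f_scaleR V_scaleR unit_vec_V abs_sgn mult.commute)
    finally show ?case using insert by simp
  qed
  moreover have "(\<Sum>k\<in>F. \<bar>f (unit_vec k)\<bar>) \<ge> n * \<eta>"
    using sum_bounded_below[of F \<eta> "\<lambda>k. \<bar>f (unit_vec k)\<bar>"] big F by auto
  moreover have "f (y F) \<le> K"
    using K(2)[OF Y_ball(1)[OF yY[OF F(3)]]] mult_left_mono[OF Y_ball(2)[OF yY[OF F(3)]] K(1)]
    by linarith
  ultimately show False using n by linarith
qed

text \<open>At a coordinate where \<open>f\<close> is small, \<open>y\<close> is replaced by the
  sign opposite to \<open>x k\<close>. The entry moves by at most 2, hence the choice of \<eta>/2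
  below. The scale \<open>s\<close> serves both kinds of vertices: 1 for points of \<open>Y\<close>
  and \<open>e r\<close> for those over \<open>r\<close>.\<close>

lemma flip_coordinate:
  assumes "y \<in> Y" "\<eta> > 0"
  obtains y' k where "y' \<in> Y" "k \<notin> B" "f y' > f y - \<eta>" "\<And>s. s \<ge> 0 \<Longrightarrow> \<bar>s * y' k - x k\<bar> \<ge> s"
proof -
  obtain k where k: "k \<notin> B" "\<bar>f (unit_vec k)\<bar> < \<eta> / 2"
    using small_coordinate[of "\<eta> / 2"] assms by auto
  define \<sigma> :: real where "\<sigma> = (if x k \<ge> 0 then - 1 else 1)"
  define y' where "y' = y + (\<sigma> - y k) *\<^sub>R unit_vec k"
  have y'k: "y' k = \<sigma>" by (simp add: y'_def scaleR_fun_apply unit_vec_def)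
  have y'i: "y' i = y i" if "i \<noteq> k" for i using that by (simp add: y'_def scaleR_fun_apply unit_vec_def)
  have y'Y: "y' \<in> Y"
    unfolding Y_def
  proof (safe)
    fix a show "\<bar>y' a\<bar> \<le> 1"
      using assms(1) y'k y'i by (cases "a = k") (auto simp: Y_def \<sigma>_def)
  next
    fix r assume "r \<in> B" then show "y' r = 0"
      using assms(1) y'i k by (cases "r = k") (auto simp: Y_def)
  qed
  have "\<bar>y k\<bar> \<le> 1" using assms(1) by (simp add: Y_def)
  then have "\<bar>\<sigma> - y k\<bar> \<le> 2" by (auto simp: \<sigma>_def)
  then have "\<bar>(\<sigma> - y k) * f (unit_vec k)\<bar> \<le> 2 * \<bar>f (unit_vec k)\<bar>"
    by (simp add: abs_mult mult_right_mono)
  moreover have "f y' = f y + (\<sigma> - y k) * f (unit_vec k)"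
    using Y_ball(1)[OF assms(1)] by (simp add: y'_def f_add f_scaleR V_scaleR unit_vec_V)
  ultimately have "f y' > f y - \<eta>" using k(2) by linarith
  moreover have "\<bar>s * y' k - x k\<bar> \<ge> s" if "s \<ge> 0" for s
    using that by (auto simp: y'k \<sigma>_def)
  ultimately show thesis using that y'Y k(1) by blast
qed

end

section \<open>Slices and the lower bound for the Daugavet constants\<close>

lemma dual_sphere_D:
  assumes "f \<in> dual_sphere V N"
  shows "bounded_functional_on V N f"
    and "\<delta> > 0 \<Longrightarrow> \<exists>x\<in>V. N x \<le> 1 \<and> f x > 1 - \<delta>"
proof -
  show f: "bounded_functional_on V N f" using assms by (simp add: dual_sphere_def)
  assume "\<delta> > 0"
  have ne: "unit_ball V N \<noteq> {}" using zero_in_V N_zero by (auto simp: unit_ball_def)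
  obtain K where K: "K \<ge> 0" "\<And>x. x \<in> V \<Longrightarrow> \<bar>f x\<bar> \<le> K * N x" using f_bound[OF f] by blast
  have "bdd_above ((\<lambda>x. \<bar>f x\<bar>) ` unit_ball V N)"
  proof (rule bdd_aboveI2)
    fix x assume "x \<in> unit_ball V N"
    then show "\<bar>f x\<bar> \<le> K"
      using K(2)[of x] mult_left_mono[of "N x" 1 K] K(1) by (auto simp: unit_ball_def)
  qed
  moreover have "1 - \<delta> < (SUP x\<in>unit_ball V N. \<bar>f x\<bar>)"
    using assms \<open>\<delta> > 0\<close> by (simp add: dual_sphere_def dual_norm_def)
  ultimately obtain x where x: "x \<in> unit_ball V N" "1 - \<delta> < \<bar>f x\<bar>"
    using less_cSUP_iff[OF ne] by blast
  then have xV: "x \<in> V" "N x \<le> 1" by (auto simp: unit_ball_def)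
  show "\<exists>x\<in>V. N x \<le> 1 \<and> f x > 1 - \<delta>"
  proof (cases "f x \<ge> 0")
    case False
    then have "f ((-1) *\<^sub>R x) > 1 - \<delta>" using x(2) xV f_scaleR[OF f, of x "-1"] by simp
    then show ?thesis using V_scaleR[OF xV(1), of "-1"] N_scaleR[OF xV(1), of "-1"] xV(2)
      by (intro bexI[of _ "(-1) *\<^sub>R x"]) simp_all
  qed (use x xV in auto)
qed

text \<open>A vertex in \<open>Y\<close> can be flipped to distance at least 1 from
  \<open>x\<close>. A vertex over \<open>r\<close> gets distance \<open>e r\<close> from its flipped
  coordinate and \<open>1 - \<bar>x r\<bar>\<close> from coordinate \<open>r\<close>. The conditions
  on \<open>c\<close> collect these bounds.\<close>

lemma far_point_in_slice:
  assumes f: "f \<in> dual_sphere V N" and \<delta>: "\<delta> > 0" and x: "x \<in> V"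
    and c: "c \<le> 1" "\<And>r. r \<in> B \<Longrightarrow> c \<le> max (e r) (1 - \<bar>x r\<bar>)"
  obtains v where "v \<in> slice V N f \<delta>" "N (v - x) \<ge> c"
proof -
  note bf = dual_sphere_D(1)[OF f]
  obtain x0 where x0: "x0 \<in> V" "N x0 \<le> 1" "f x0 > 1 - \<delta>" using dual_sphere_D(2)[OF f \<delta>] by blast
  \<comment> \<open>If no vertex lay in the slice, \<open>f\<close> would be at most
    \<open>1 - \<delta>\<close> on the whole ball, contradicting \<open>x0\<close>.\<close>
  then consider (base) y where "y \<in> Y" "f y > 1 - \<delta>"
    | (apex) y r s where "y \<in> Y" "r \<in> B" "\<bar>s\<bar> = 1" "f (e r *\<^sub>R y + s *\<^sub>R unit_vec r) > 1 - \<delta>"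
    using f_le_of_vertices[OF bf, of "1 - \<delta>" x0] by (meson leD leI)
  then show thesis
  proof cases
    case base
    \<comment> \<open>The permitted loss is exactly the slack of \<open>y\<close> in the slice, so
      \<open>y'\<close> stays in it.\<close>
    obtain y' k where y': "y' \<in> Y" "k \<notin> B" "f y' > f y - (f y - (1 - \<delta>))"
      "\<And>s. s \<ge> 0 \<Longrightarrow> \<bar>s * y' k - x k\<bar> \<ge> s"
      using flip_coordinate[OF bf base(1), of "f y - (1 - \<delta>)" x] base(2) by auto
    have "1 \<le> N (y' - x)"
      using y'(4)[of 1] abs_le_N[OF V_diff[OF Y_ball(1)[OF y'(1)] x], of k] by simp
    then show thesis using that[of y'] y' Y_ball[of y'] c(1) by (auto simp: slice_def unit_ball_def)
  next
    case apex
    let ?u = "\<lambda>y. e r *\<^sub>R y + s *\<^sub>R unit_vec r"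
    have fu: "f (?u y) = e r * f y + s * f (unit_vec r)" if "y \<in> Y" for y
      using Y_ball(1)[OF that] by (simp add: f_add[OF bf] f_scaleR[OF bf] V_scaleR unit_vec_V)
    obtain y' k where y': "y' \<in> Y" "k \<notin> B" "f y' > f y - (f (?u y) - (1 - \<delta>))"
      "\<And>s. s \<ge> 0 \<Longrightarrow> \<bar>s * y' k - x k\<bar> \<ge> s"
      using flip_coordinate[OF bf apex(1), of "f (?u y) - (1 - \<delta>)" x] apex(4) by auto
    \<comment> \<open>Scaling by \<open>e r \<le> 1\<close> only shrinks a loss in \<open>f\<close>;
      the \<open>max\<close> covers the case where the flip is a gain.\<close>
    have "e r * (f y - f y') \<le> max 0 (f y - f y')"
      using e_pos[OF apex(2)] e_le[OF apex(2)]
      by (cases "f y \<ge> f y'") (auto simp: mult_left_le_one_le mult_le_0_iff)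
    then have "e r * (f y - f y') < f (?u y) - (1 - \<delta>)" using y'(3) apex(4) by auto
    then have "f (?u y') > 1 - \<delta>" using fu[OF apex(1)] fu[OF y'(1)] by (simp add: algebra_simps)
    moreover have v: "?u y' \<in> V" "N (?u y') \<le> 1" by (fact vertex_ball[OF y'(1) apex(2,3)])+
    moreover have "e r \<le> N (?u y' - x)"
    proof -
      have "k \<noteq> r" using y'(2) apex(2) by blast
      then have "(?u y' - x) k = e r * y' k - x k" by (simp add: scaleR_fun_apply unit_vec_def)
      then show ?thesis
        using y'(4)[of "e r"] e_pos[OF apex(2)] abs_le_N[OF V_diff[OF v(1) x], of k] by simp
    qed
    moreover have "1 - \<bar>x r\<bar> \<le> N (?u y' - x)"
    proof -
      have "(?u y' - x) r = s - x r"
        using y'(1) apex(2) by (simp add: scaleR_fun_apply unit_vec_def Y_def)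
      then show ?thesis using abs_le_N[OF V_diff[OF v(1) x], of r] apex(3) by simp
    qed
    ultimately show thesis
      using that[of "?u y'"] c(2)[OF apex(2)] by (auto simp: slice_def unit_ball_def)
  qed
qed

text \<open>The norm 1 is attained at \<open>unit_vec k\<close>. These functionals cut out the small
  slices for \<open>k \<in> B\<close>, and they also witness that the dual sphere is
  nonempty.\<close>

lemma coordinate_dual_sphere: "(\<lambda>x. x k) \<in> dual_sphere V N"
proof -
  have "(SUP x\<in>unit_ball V N. \<bar>x k\<bar>) = 1"
  proof (rule cSup_eq_maximum)
    show "1 \<in> (\<lambda>x. \<bar>x k\<bar>) ` unit_ball V N"
      using unit_vec_V N_unit_vec
      by (intro image_eqI[of _ _ "unit_vec k"]) (auto simp: unit_ball_def unit_vec_def)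
    show "z \<le> 1" if "z \<in> (\<lambda>x. \<bar>x k\<bar>) ` unit_ball V N" for z
      using that abs_le_N by (auto simp: unit_ball_def intro: order_trans)
  qed
  moreover have "bounded_functional_on V N (\<lambda>x. x k)"
    using abs_le_N unfolding bounded_functional_on_def
    by (auto simp: scaleR_fun_apply intro!: exI[of _ 1])
  ultimately show ?thesis by (simp add: dual_sphere_def dual_norm_def)
qed

text \<open>A real \<open>Sup\<close> carries information only for bounded sets. A slice of width 3
  is the whole ball, and the bound is the diameter bound 2 plus the chosen \<epsilon> = 1.\<close>

lemma delta_const_set_le:
  assumes "x \<in> unit_ball V N" "\<alpha> \<ge> 0"
    "\<forall>\<epsilon>>0. \<forall>\<delta>>0. \<forall>f\<in>dual_sphere V N. x \<in> slice V N f \<delta> \<longrightarrow>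
      (\<exists>y\<in>slice V N f \<delta>. N (y - x) > \<alpha> - \<epsilon>)"
  shows "\<alpha> \<le> 3"
proof -
  have x: "x \<in> V" "N x \<le> 1" using assms(1) by (auto simp: unit_ball_def)
  obtain k :: 'a where True by blast
  have "x k > 1 - 3" using abs_le_N[OF x(1), of k] x(2) by linarith
  then have "x \<in> slice V N (\<lambda>x. x k) 3" using assms(1) by (simp add: slice_def)
  then obtain y where "y \<in> slice V N (\<lambda>x. x k) 3" "N (y - x) > \<alpha> - 1"
    using assms(3)[rule_format, of 1 3 "\<lambda>x. x k"] coordinate_dual_sphere by auto
  then show ?thesis using N_diff_le[of y x] x by (auto simp: slice_def unit_ball_def)
qed

lemma delta_const_nonneg:
  assumes "x \<in> unit_sphere V N"
  shows "delta_const V N x \<ge> 0"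
  unfolding delta_const_def
proof (rule cSup_upper)
  have x: "x \<in> V" "x \<in> unit_ball V N" using assms by (auto simp: unit_sphere_def unit_ball_def)
  have "\<exists>y\<in>slice V N f \<delta>. N (y - x) > 0 - \<epsilon>"
    if "\<epsilon> > 0" "f \<in> dual_sphere V N" "x \<in> slice V N f \<delta>" for \<epsilon> \<delta> f
    using that N_zero by (intro bexI[of _ x]) auto
  then show "0 \<in> {\<alpha>. \<alpha> \<ge> 0 \<and>
    (\<forall>\<epsilon>>0. \<forall>\<delta>>0. \<forall>f\<in>dual_sphere V N. x \<in> slice V N f \<delta> \<longrightarrow>
      (\<exists>y\<in>slice V N f \<delta>. N (y - x) > \<alpha> - \<epsilon>))}"
    by blast
  show "bdd_above {\<alpha>. \<alpha> \<ge> 0 \<and>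
    (\<forall>\<epsilon>>0. \<forall>\<delta>>0. \<forall>f\<in>dual_sphere V N. x \<in> slice V N f \<delta> \<longrightarrow>
      (\<exists>y\<in>slice V N f \<delta>. N (y - x) > \<alpha> - \<epsilon>))}"
    using delta_const_set_le[OF x(2)] by (intro bdd_aboveI[of _ 3]) blast
qed

lemma daugavet_const_pos:
  assumes "x \<in> unit_sphere V N"
  shows "daugavet_const V N x > 0"
proof -
  have x: "x \<in> V" "N x = 1" "x \<in> unit_ball V N"
    using assms by (auto simp: unit_sphere_def unit_ball_def)
  have "\<exists>c>0. c \<le> 1 \<and> (\<forall>r\<in>B. c \<le> max (e r) (1 - \<bar>x r\<bar>))"
  proof (cases "\<exists>r\<in>B. \<bar>x r\<bar> > 1/2")
    case True
    then obtain r where r: "r \<in> B" "\<bar>x r\<bar> > 1/2" by blast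
    \<comment> \<open>The total mass on \<open>B\<close> is at most 1, so every other coordinate
      gives \<open>1 - \<bar>x t\<bar> \<ge> 1/2\<close>, and only the weight of the exceptional
      \<open>r\<close> enters \<open>c\<close>.\<close>
    have "\<bar>x t\<bar> \<le> 1/2" if "t \<in> B" "t \<noteq> r" for t
      using sum_le_N[OF x(1), of "{r, t}"] r that x(2) by simp
    then show ?thesis
      using e_pos[OF r(1)] by (intro exI[of _ "min (1/2) (e r)"]) (force simp: min_le_iff_disj le_max_iff_disj)
  next
    case False
    then show ?thesis by (intro exI[of _ "1/2"]) (force simp: le_max_iff_disj)
  qed
  then obtain c where c: "c > 0" "c \<le> 1" "\<And>r. r \<in> B \<Longrightarrow> c \<le> max (e r) (1 - \<bar>x r\<bar>)" by blast
  have far: "\<exists>y\<in>slice V N f \<delta>. N (y - x) > c - \<epsilon>"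
    if "\<epsilon> > 0" and \<delta>: "\<delta> > 0" and f: "f \<in> dual_sphere V N" for \<epsilon> \<delta> f
  proof -
    obtain v where "v \<in> slice V N f \<delta>" "N (v - x) \<ge> c"
      using far_point_in_slice[OF f \<delta> x(1) c(2,3)] by blast
    then show ?thesis using \<open>\<epsilon> > 0\<close> by (intro bexI[of _ v]) auto
  qed
  have "c \<le> daugavet_const V N x"
    unfolding daugavet_const_def
  proof (rule cSup_upper)
    show "c \<in> {\<alpha>. \<alpha> \<ge> 0 \<and>
      (\<forall>\<epsilon>>0. \<forall>\<delta>>0. \<forall>f\<in>dual_sphere V N. \<exists>y\<in>slice V N f \<delta>. N (y - x) > \<alpha> - \<epsilon>)}"
      using c(1) far by (simp add: less_imp_le)
    \<comment> \<open>The Daugavet condition ranges over all slices, including those containing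
      \<open>x\<close>, so its set lies inside the one for the \<Delta>-constant.\<close>
    show "bdd_above {\<alpha>. \<alpha> \<ge> 0 \<and>
      (\<forall>\<epsilon>>0. \<forall>\<delta>>0. \<forall>f\<in>dual_sphere V N. \<exists>y\<in>slice V N f \<delta>. N (y - x) > \<alpha> - \<epsilon>)}"
      using delta_const_set_le[OF x(3)] by (intro bdd_aboveI[of _ 3]) blast
  qed
  then show ?thesis using c(1) by linarith
qed

section \<open>Small slices at unit vectors and the infimum of the \<Delta>-constants\<close>

lemma slice_coordinate_radius:
  assumes "r \<in> B" "0 < \<delta>" "y \<in> slice V N (\<lambda>x. x r) \<delta>"
  shows "N (y - unit_vec r) \<le> e r + 3 * \<delta>"
proof -
  have y: "y \<in> V" "N y \<le> 1" "y r > 1 - \<delta>" using assms(3) by (auto simp: slice_def unit_ball_def)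
  have yr: "y r \<le> 1" using abs_le_N[OF y(1), of r] y(2) by linarith
  \<comment> \<open>Coordinate \<open>r\<close> is within \<delta> of 1, which leaves mass less than
    \<delta> for the rest of \<open>B\<close>.\<close>
  have 1: "(\<Sum>t\<in>F. \<bar>(y - unit_vec r) t\<bar>) \<le> 2 * \<delta>" if F: "finite F" "F \<subseteq> B" for F
  proof -
    have "(\<Sum>t\<in>F. \<bar>(y - unit_vec r) t\<bar>) \<le> (\<Sum>t\<in>insert r F. \<bar>(y - unit_vec r) t\<bar>)"
      using F by (intro sum_mono2) auto
    also have "\<dots> = \<bar>y r - 1\<bar> + (\<Sum>t\<in>F - {r}. \<bar>(y - unit_vec r) t\<bar>)"
      using F by (simp add: sum.insert_remove unit_vec_def)
    also have "(\<Sum>t\<in>F - {r}. \<bar>(y - unit_vec r) t\<bar>) = (\<Sum>t\<in>F - {r}. \<bar>y t\<bar>)"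
      by (intro sum.cong) (auto simp: unit_vec_def)
    finally show ?thesis
      using sum_le_N[OF y(1), of "insert r F"] F assms(1) y(2,3) yr
      by (simp add: sum.insert_remove)
  qed
  \<comment> \<open>The weighted sum costs at most 2\<delta> by the previous bound. The mass at
    \<open>r\<close> leaves at most \<open>1 - (1 - e r) * \<bar>y r\<bar>\<close>, hence at most
    \<open>e r + \<delta>\<close>, for coordinate \<open>a\<close>.\<close>
  have 2: "\<bar>(y - unit_vec r) a\<bar> + (\<Sum>t\<in>F. (1 - e t) * \<bar>(y - unit_vec r) t\<bar>) \<le> e r + 3 * \<delta>"
    if F: "finite F" "F \<subseteq> B" "a \<notin> B" for F a
  proof -
    have "(\<Sum>t\<in>F. (1 - e t) * \<bar>(y - unit_vec r) t\<bar>) \<le> (\<Sum>t\<in>F. \<bar>(y - unit_vec r) t\<bar>)"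
      using F e_pos e_le by (intro sum_mono) (auto simp: mult_left_le_one_le less_imp_le subsetD)
    moreover have "\<bar>(y - unit_vec r) a\<bar> \<le> 1 - (1 - e r) * \<bar>y r\<bar>"
    proof -
      have "a \<noteq> r" using F assms(1) by blast
      then show ?thesis using abs_add_sum_le_N[OF y(1), of "{r}" a] F assms(1) y(2)
        by (simp add: unit_vec_def)
    qed
    moreover have "(1 - e r) * \<bar>y r\<bar> \<ge> (1 - e r) - \<delta>"
    proof -
      have "(1 - e r) * (1 - \<bar>y r\<bar>) \<le> max 0 (1 - \<bar>y r\<bar>)"
        using e_pos[OF assms(1)] e_le[OF assms(1)]
        by (cases "\<bar>y r\<bar> \<le> 1") (auto simp: mult_left_le_one_le mult_le_0_iff)
      then show ?thesis using y(3) assms(2) by (simp add: algebra_simps)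
    qed
    ultimately show ?thesis using 1[OF F(1,2)] by linarith
  qed
  have "(\<Sum>t\<in>F. \<bar>(y - unit_vec r) t\<bar>) \<le> e r + 3 * \<delta>" if "finite F" "F \<subseteq> B" for F
    using 1[OF that] e_pos[OF assms(1)] assms(2) by linarith
  then show ?thesis using 2 by (rule in_V_N_leI(2))
qed

lemma delta_const_unit_vec:
  assumes "r \<in> B"
  shows "delta_const V N (unit_vec r) \<le> e r"
  unfolding delta_const_def
proof (rule cSup_least)
  have "\<exists>y\<in>slice V N f \<delta>. N (y - unit_vec r) > 0 - \<epsilon>"
    if "\<epsilon> > 0" "f \<in> dual_sphere V N" "unit_vec r \<in> slice V N f \<delta>" for \<epsilon> \<delta> f
    using that N_zero by (intro bexI[of _ "unit_vec r"]) auto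
  then show "{\<alpha>. \<alpha> \<ge> 0 \<and>
    (\<forall>\<epsilon>>0. \<forall>\<delta>>0. \<forall>f\<in>dual_sphere V N. unit_vec r \<in> slice V N f \<delta> \<longrightarrow>
      (\<exists>y\<in>slice V N f \<delta>. N (y - unit_vec r) > \<alpha> - \<epsilon>))} \<noteq> {}"
    by blast
  fix \<alpha> assume "\<alpha> \<in> {\<alpha>. \<alpha> \<ge> 0 \<and>
    (\<forall>\<epsilon>>0. \<forall>\<delta>>0. \<forall>f\<in>dual_sphere V N. unit_vec r \<in> slice V N f \<delta> \<longrightarrow>
      (\<exists>y\<in>slice V N f \<delta>. N (y - unit_vec r) > \<alpha> - \<epsilon>))}"
  then have \<alpha>: "\<exists>y\<in>slice V N f \<delta>. N (y - unit_vec r) > \<alpha> - \<epsilon>"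
    if "\<epsilon> > 0" "\<delta> > 0" "f \<in> dual_sphere V N" "unit_vec r \<in> slice V N f \<delta>" for \<epsilon> \<delta> f
    using that by blast
  show "\<alpha> \<le> e r"
  proof (rule field_le_epsilon)
    fix \<theta> :: real assume "\<theta> > 0"
    \<comment> \<open>Width \<theta>/6 gives radius at most \<open>e r + \<theta> / 2\<close>, and
      \<epsilon> = \<theta>/2 uses up the other half.\<close>
    have "unit_vec r \<in> slice V N (\<lambda>x. x r) (\<theta> / 6)"
      using \<open>\<theta> > 0\<close> unit_vec_V N_unit_vec by (auto simp: slice_def unit_ball_def unit_vec_def)
    then obtain y where "y \<in> slice V N (\<lambda>x. x r) (\<theta> / 6)" "N (y - unit_vec r) > \<alpha> - \<theta> / 2"
      using \<alpha>[of "\<theta> / 2" "\<theta> / 6" "\<lambda>x. x r"] \<open>\<theta> > 0\<close> coordinate_dual_sphere by auto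
    then show "\<alpha> \<le> e r + \<theta>"
      using slice_coordinate_radius[OF assms, of "\<theta> / 6" y] \<open>\<theta> > 0\<close> by simp
  qed
qed

lemma unit_vec_sphere: "unit_vec r \<in> unit_sphere V N"
  by (simp add: unit_sphere_def unit_vec_V N_unit_vec)

lemma Inf_delta_const:
  assumes small: "\<And>\<epsilon>. \<epsilon> > 0 \<Longrightarrow> \<exists>r\<in>B. e r \<le> \<epsilon>"
  shows "(INF x\<in>unit_sphere V N. delta_const V N x) = 0"
proof (rule antisym)
  have bdd: "bdd_below (delta_const V N ` unit_sphere V N)"
    using delta_const_nonneg by (intro bdd_belowI2)
  show "(INF x\<in>unit_sphere V N. delta_const V N x) \<le> 0"
  proof (rule field_le_epsilon)
    fix \<epsilon> :: real assume "\<epsilon> > 0"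
    then obtain r where r: "r \<in> B" "e r \<le> \<epsilon>" using small by blast
    have "(INF x\<in>unit_sphere V N. delta_const V N x) \<le> delta_const V N (unit_vec r)"
      using bdd unit_vec_sphere by (rule cINF_lower)
    then show "(INF x\<in>unit_sphere V N. delta_const V N x) \<le> 0 + \<epsilon>"
      using delta_const_unit_vec[OF r(1)] r(2) by linarith
  qed
  show "0 \<le> (INF x\<in>unit_sphere V N. delta_const V N x)"
    using unit_vec_sphere delta_const_nonneg by (intro cINF_greatest) auto
qed

end

theorem theorem2p16:
  shows "\<exists>(V :: (real \<Rightarrow> real) set) (N :: (real \<Rightarrow> real) \<Rightarrow> real).
    banach_space_on V N \<and> V \<noteq> {0} \<and>
    (INF x\<in>unit_sphere V N. delta_const V N x) = 0 \<and>
    (\<forall>x\<in>unit_sphere V N. daugavet_const V N x > 0)"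
proof -
  \<comment> \<open>Each number in (0, 1] indexes its own weight, so the weights have infimum 0,
    while the remaining reals give infinitely many coordinates for the bounded summand.\<close>
  interpret l1_linf_sum "{0<..1}" "\<lambda>r::real. r"
  proof
    have "{..0} \<subseteq> - {0<..1::real}" by auto
    then show "infinite (- {0<..1::real})" using infinite_Iic infinite_super by blast
  qed auto
  have "unit_vec 0 \<noteq> 0" by (auto simp: unit_vec_def fun_eq_iff)
  then have "V \<noteq> {0}" using unit_vec_V by blast
  moreover have "\<exists>r\<in>{0<..1}. r \<le> \<epsilon>" if "\<epsilon> > 0" for \<epsilon> :: real
    using that by (intro bexI[of _ "min 1 \<epsilon>"]) auto
  ultimately show ?thesis
    using banach_space_on_V Inf_delta_const daugavet_const_pos by blast
qed

end
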